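(* Let $L>0$. Define $h_{-1}:=0$ and $h_k:=1+\dfrac{2}{1+\sqrt{9-4h_{k-1}}}$ for $k\ge0$, and let $\mathcal A$ be gradient descent with this stepsize schedule, $x_{k+1}=x_k-\frac{h_k}{L}\nabla f(x_k)$, $k\ge0$. Then $$\mathcal G_N(\mathcal A)=2-h_{N-1}\qquad\text{for every }N\ge1,$$ and $N\,\mathcal G_N(\mathcal A)\to\frac12$ as $N\to\infty$.
   Context: Fix $L>0$. $\mathcal F_{0,L}(\mathbb R^d)$ is the class of convex differentiable functions $f:\mathbb R^d\to\mathbb R$ that admit a minimizer and whose gradient is $L$-Lipschitz (Euclidean norm); $f_\star:=\min f$. For a method $\mathcal A$ generating iterates $x_1,x_2,\ldots$ from $f$ and $x_0$, its worst-case bound after $N$ iterations is $$\mathcal G_N(\mathcal A):=\sup_{d\ge1,\ f\in\mathcal F_{0,L}(\mathbb R^d),\ x_0\in\mathbb R^d,\ f(x_0)>f_\star}\frac{\|\nabla f(x_N)\|^2}{L(f(x_0)-f_\star)}.$$ *)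

theory Defs
  imports "HOL-Analysis.Analysis"
begin

text \<open>
  The worst-case bound is a supremum over all dimensions \<open>d\<close>, so the spaces \<open>\<real>\<^sup>d\<close> have to live in
  one type. That type is the inner product space of finitely supported real sequences, in which
  \<open>\<real>\<^sup>d\<close> is the subspace of the sequences supported in \<open>{..<d}\<close>, with its Euclidean norm.
\<close>

typedef fseq = "{x :: nat \<Rightarrow> real. finite {i. x i \<noteq> 0}}"
  morphisms coord Abs_fseq
  by (rule exI[of _ "\<lambda>_. 0"]) simp

setup_lifting type_definition_fseq

lemma fseq_eqI: "(\<And>i. coord x i = coord y i) \<Longrightarrow> x = y"
  by (metis coord_inject ext)

lemma finite_support: "finite {i. coord x i \<noteq> 0}"
  using coord[of x] by simp

instantiation fseq :: real_vector
begin

lift_definition zero_fseq :: fseq is "\<lambda>_. 0" by simp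

lift_definition plus_fseq :: "fseq \<Rightarrow> fseq \<Rightarrow> fseq" is "\<lambda>x y i. x i + y i"
proof -
  fix x y :: "nat \<Rightarrow> real"
  assume "finite {i. x i \<noteq> 0}" "finite {i. y i \<noteq> 0}"
  then show "finite {i. x i + y i \<noteq> 0}"
    by (rule finite_subset[OF _ finite_UnI, rotated]) auto
qed

lift_definition minus_fseq :: "fseq \<Rightarrow> fseq \<Rightarrow> fseq" is "\<lambda>x y i. x i - y i"
proof -
  fix x y :: "nat \<Rightarrow> real"
  assume "finite {i. x i \<noteq> 0}" "finite {i. y i \<noteq> 0}"
  then show "finite {i. x i - y i \<noteq> 0}"
    by (rule finite_subset[OF _ finite_UnI, rotated]) auto
qed

lift_definition uminus_fseq :: "fseq \<Rightarrow> fseq" is "\<lambda>x i. - x i" by simp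

lift_definition scaleR_fseq :: "real \<Rightarrow> fseq \<Rightarrow> fseq" is "\<lambda>r x i. r * x i"
  by (rule finite_subset[rotated]) auto

instance
  by standard (transfer; simp add: algebra_simps fun_eq_iff)+

end

lemma coord_simps [simp]:
  "coord 0 i = 0"
  "coord (x + y) i = coord x i + coord y i"
  "coord (x - y) i = coord x i - coord y i"
  "coord (- x) i = - coord x i"
  "coord (r *\<^sub>R x) i = r * coord x i"
  by (transfer; simp)+

instantiation fseq :: real_inner
begin

definition inner_fseq :: "fseq \<Rightarrow> fseq \<Rightarrow> real" where
  "inner_fseq x y = (\<Sum>i | coord x i \<noteq> 0. coord x i * coord y i)"

definition norm_fseq :: "fseq \<Rightarrow> real" where
  "norm_fseq x = sqrt (x \<bullet> x)"

definition sgn_fseq :: "fseq \<Rightarrow> fseq" where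
  "sgn_fseq x = x /\<^sub>R norm x"

definition dist_fseq :: "fseq \<Rightarrow> fseq \<Rightarrow> real" where
  "dist_fseq x y = norm (x - y)"

definition uniformity_fseq :: "(fseq \<times> fseq) filter" where
  "uniformity_fseq = (INF e\<in>{0<..}. principal {(x, y). dist x y < e})"

definition open_fseq :: "fseq set \<Rightarrow> bool" where
  "open_fseq U \<longleftrightarrow> (\<forall>x\<in>U. \<forall>\<^sub>F (x', y) in uniformity. x' = x \<longrightarrow> y \<in> U)"

lemma inner_fseq_superset:
  assumes "finite A" "{i. coord x i \<noteq> 0} \<subseteq> A"
  shows "x \<bullet> y = (\<Sum>i\<in>A. coord x i * coord y i)"
  unfolding inner_fseq_def by (rule sum.mono_neutral_left) (use assms in auto)

instance
proof
  fix x y z :: fseq and r :: real and U :: "fseq set"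
  let ?A = "{i. coord x i \<noteq> 0} \<union> {i. coord y i \<noteq> 0}"
  have A: "finite ?A" by (simp add: finite_support)
  show "dist x y = norm (x - y)" by (rule dist_fseq_def)
  show "sgn x = x /\<^sub>R norm x" by (rule sgn_fseq_def)
  show "uniformity = (INF e\<in>{0<..}. principal {(x, y::fseq). dist x y < e})"
    by (rule uniformity_fseq_def)
  show "open U = (\<forall>x\<in>U. \<forall>\<^sub>F (x', y) in uniformity. x' = x \<longrightarrow> y \<in> U)"
    by (rule open_fseq_def)
  show "norm x = sqrt (x \<bullet> x)" by (rule norm_fseq_def)
  have "x \<bullet> y = (\<Sum>i\<in>?A. coord x i * coord y i)" by (rule inner_fseq_superset[OF A]) auto
  moreover have "y \<bullet> x = (\<Sum>i\<in>?A. coord y i * coord x i)"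
    by (rule inner_fseq_superset[OF A]) auto
  ultimately show "x \<bullet> y = y \<bullet> x" by (simp add: mult.commute)
  have "(x + y) \<bullet> z = (\<Sum>i\<in>?A. coord (x + y) i * coord z i)"
    by (rule inner_fseq_superset[OF A]) auto
  moreover have "x \<bullet> z = (\<Sum>i\<in>?A. coord x i * coord z i)"
    by (rule inner_fseq_superset[OF A]) auto
  moreover have "y \<bullet> z = (\<Sum>i\<in>?A. coord y i * coord z i)"
    by (rule inner_fseq_superset[OF A]) auto
  ultimately show "(x + y) \<bullet> z = x \<bullet> z + y \<bullet> z"
    by (simp add: distrib_right sum.distrib)
  have "(r *\<^sub>R x) \<bullet> y = (\<Sum>i | coord x i \<noteq> 0. coord (r *\<^sub>R x) i * coord y i)"
    by (rule inner_fseq_superset[OF finite_support]) auto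
  then show "(r *\<^sub>R x) \<bullet> y = r * (x \<bullet> y)"
    by (simp add: inner_fseq_def sum_distrib_left mult.assoc)
  show "0 \<le> x \<bullet> x" by (simp add: inner_fseq_def sum_nonneg)
  have "x \<bullet> x = 0 \<longleftrightarrow> (\<forall>i \<in> {i. coord x i \<noteq> 0}. coord x i * coord x i = 0)"
    unfolding inner_fseq_def by (rule sum_nonneg_eq_0_iff) (simp_all add: finite_support)
  also have "\<dots> \<longleftrightarrow> x = 0"
    by (auto intro: fseq_eqI)
  finally show "x \<bullet> x = 0 \<longleftrightarrow> x = 0" .
qed

end

definition Rd :: "nat \<Rightarrow> fseq set" where
  "Rd d = {x. \<forall>i\<ge>d. coord x i = 0}"

lemma inner_Rd:
  assumes "x \<in> Rd d"
  shows "x \<bullet> y = (\<Sum>i<d. coord x i * coord y i)"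
  by (rule inner_fseq_superset) (use assms in \<open>auto simp: Rd_def not_less[symmetric]\<close>)

lemma norm_Rd: "x \<in> Rd d \<Longrightarrow> norm x = L2_set (coord x) {..<d}"
  by (simp add: norm_fseq_def inner_Rd L2_set_def power2_eq_square)

text \<open>
  A function on \<open>\<real>\<^sup>d\<close> is given by the restriction to \<^term>\<open>Rd d\<close> of a function on \<^typ>\<open>fseq\<close>; its
  values elsewhere are irrelevant for everything below.
\<close>

definition grad :: "nat \<Rightarrow> (fseq \<Rightarrow> real) \<Rightarrow> fseq \<Rightarrow> fseq" where
  "grad d f x = (THE g. g \<in> Rd d \<and> (f has_derivative (\<lambda>v. g \<bullet> v)) (at x within Rd d))"

text \<open>The description defining \<^const>\<open>grad\<close> is proper wherever the function is differentiable.\<close>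

lemma subspace_Rd: "subspace (Rd d)"
  by (auto simp: subspace_def Rd_def)

lemma gradient_exists:
  fixes f :: "fseq \<Rightarrow> real"
  assumes x: "x \<in> Rd d" and f: "f differentiable (at x within Rd d)"
  shows "\<exists>g\<in>Rd d. (f has_derivative (\<lambda>v. g \<bullet> v)) (at x within Rd d)"
proof -
  obtain D where D: "(f has_derivative D) (at x within Rd d)"
    using f by (auto simp: differentiable_def)
  then interpret D: bounded_linear D by (rule has_derivative_bounded_linear)
  define e where "e i = Abs_fseq (\<lambda>j. if j = i then 1 else 0)" for i :: nat
  have ce: "coord (e i) j = (if j = i then 1 else 0)" for i j
    unfolding e_def by (subst Abs_fseq_inverse) simp_all
  have cs: "coord (\<Sum>i\<in>S. F i) j = (\<Sum>i\<in>S. coord (F i) j)" for F :: "nat \<Rightarrow> fseq" and S j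
    by (induction S rule: infinite_finite_induct) auto
  define g where "g = (\<Sum>i<d. D (e i) *\<^sub>R e i)"
  have cg: "coord g j = (if j < d then D (e j) else 0)" for j
    by (simp add: g_def cs ce if_distrib[of "\<lambda>t. _ * t"] cong: if_cong)
  have g: "g \<in> Rd d" by (simp add: Rd_def cg)
  have Dv: "D v = g \<bullet> v" if v: "v \<in> Rd d" for v
  proof -
    have "v = (\<Sum>i<d. coord v i *\<^sub>R e i)"
      using v by (intro fseq_eqI)
        (simp add: cs ce Rd_def if_distrib[of "\<lambda>t. _ * t"] cong: if_cong)
    then have "D v = D (\<Sum>i<d. coord v i *\<^sub>R e i)" by (rule arg_cong)
    also have "\<dots> = (\<Sum>i<d. coord v i * D (e i))" by (simp add: D.sum D.scaleR)
    also have "\<dots> = g \<bullet> v" by (simp add: inner_Rd[OF g] cg mult.commute)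
    finally show ?thesis .
  qed
  have "(f has_derivative (\<lambda>v. g \<bullet> v)) (at x within Rd d)"
    unfolding has_derivative_within
  proof
    show "bounded_linear ((\<bullet>) g)" by (rule bounded_linear_inner_right)
    have "((\<lambda>y. (1 / norm (y - x)) *\<^sub>R (f y - (f x + D (y - x)))) \<longlongrightarrow> 0) (at x within Rd d)"
      using D by (simp add: has_derivative_within)
    moreover have "\<forall>\<^sub>F y in at x within Rd d. (1 / norm (y - x)) *\<^sub>R (f y - (f x + D (y - x)))
        = (1 / norm (y - x)) *\<^sub>R (f y - (f x + g \<bullet> (y - x)))"
      unfolding eventually_at_filter
      by (rule always_eventually) (simp add: Dv subspace_diff[OF subspace_Rd] x)
    ultimately show "((\<lambda>y. (1 / norm (y - x)) *\<^sub>R (f y - (f x + g \<bullet> (y - x)))) \<longlongrightarrow> 0)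
        (at x within Rd d)"
      by (rule Lim_transform_eventually)
  qed
  with g show ?thesis by blast
qed

lemma gradient_unique:
  assumes x: "x \<in> Rd d" and g: "g \<in> Rd d" "g' \<in> Rd d"
    and D: "(f has_derivative (\<lambda>v. g \<bullet> v)) (at x within Rd d)"
      "(f has_derivative (\<lambda>v. g' \<bullet> v)) (at x within Rd d)"
  shows "g = g'"
proof -
  define w where "w = g - g'"
  have w: "w \<in> Rd d" unfolding w_def by (rule subspace_diff[OF subspace_Rd g])
  have line: "x + t *\<^sub>R w \<in> Rd d" for t
    by (intro subspace_add[OF subspace_Rd] subspace_scale[OF subspace_Rd] x w)
  have "((\<lambda>t. f (x + t *\<^sub>R w)) has_real_derivative u \<bullet> w) (at 0)"
    if u: "(f has_derivative (\<lambda>v. u \<bullet> v)) (at x within Rd d)" for u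
  proof -
    have "((\<lambda>t. x + t *\<^sub>R w) has_derivative (\<lambda>t. t *\<^sub>R w)) (at 0)"
      by (auto intro!: derivative_eq_intros)
    moreover have "(f has_derivative (\<lambda>v. u \<bullet> v))
        (at (x + 0 *\<^sub>R w) within range (\<lambda>t. x + t *\<^sub>R w))"
      using has_derivative_subset[OF u, of "range (\<lambda>t. x + t *\<^sub>R w)"] line by auto
    ultimately have "((\<lambda>t. f (x + t *\<^sub>R w)) has_derivative (\<lambda>t. u \<bullet> (t *\<^sub>R w))) (at 0)"
      by (rule has_derivative_in_compose)
    then show ?thesis
      by (simp add: has_field_derivative_def mult_commute_abs)
  qed
  from this[OF D(1)] this[OF D(2)] have "g \<bullet> w = g' \<bullet> w" by (rule DERIV_unique)
  then have "w \<bullet> w = 0" by (simp add: w_def inner_diff_left)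
  then show ?thesis by (simp add: w_def)
qed

lemma grad_props:
  assumes "x \<in> Rd d" "f differentiable (at x within Rd d)"
  shows "grad d f x \<in> Rd d"
    and "(f has_derivative (\<lambda>v. grad d f x \<bullet> v)) (at x within Rd d)"
proof -
  have "\<exists>!g. g \<in> Rd d \<and> (f has_derivative (\<lambda>v. g \<bullet> v)) (at x within Rd d)"
    using gradient_exists[OF assms] gradient_unique[OF assms(1)] by blast
  from theI'[OF this] show "grad d f x \<in> Rd d"
    and "(f has_derivative (\<lambda>v. grad d f x \<bullet> v)) (at x within Rd d)"
    by (simp_all add: grad_def)
qed

definition smooth_convex :: "nat \<Rightarrow> real \<Rightarrow> (fseq \<Rightarrow> real) set" where
  "smooth_convex d L = {f. convex_on (Rd d) f \<and> f differentiable_on Rd d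
     \<and> (\<exists>z\<in>Rd d. \<forall>x\<in>Rd d. f z \<le> f x) \<and> L-lipschitz_on (Rd d) (grad d f)}"

definition fstar :: "nat \<Rightarrow> (fseq \<Rightarrow> real) \<Rightarrow> real" where
  "fstar d f = (INF x\<in>Rd d. f x)"

text \<open>A method maps \<open>d\<close>, \<open>f\<close> and \<open>x\<^sub>0\<close> to the sequence of iterates.\<close>

type_synonym iterative_method = "nat \<Rightarrow> (fseq \<Rightarrow> real) \<Rightarrow> fseq \<Rightarrow> nat \<Rightarrow> fseq"

definition worst_case :: "real \<Rightarrow> iterative_method \<Rightarrow> nat \<Rightarrow> ereal" where
  "worst_case L A N = Sup {ereal ((norm (grad d f (A d f x0 N)))\<^sup>2 / (L * (f x0 - fstar d f))) |
     d f x0. d \<ge> 1 \<and> f \<in> smooth_convex d L \<and> x0 \<in> Rd d \<and> f x0 > fstar d f}"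

primrec gradient_descent :: "real \<Rightarrow> (nat \<Rightarrow> real) \<Rightarrow> iterative_method" where
  "gradient_descent L h d f x0 0 = x0"
| "gradient_descent L h d f x0 (Suc k) = gradient_descent L h d f x0 k
     - (h k / L) *\<^sub>R grad d f (gradient_descent L h d f x0 k)"

text \<open>The value at index \<open>0\<close> is the recursion applied to \<open>h\<^sub>-\<^sub>1 = 0\<close>.\<close>

primrec stepsize :: "nat \<Rightarrow> real" where
  "stepsize 0 = 1 + 2 / (1 + sqrt (9 - 4 * 0))"
| "stepsize (Suc k) = 1 + 2 / (1 + sqrt (9 - 4 * stepsize k))"

end

theory Submission
  imports Defs "HOL-Real_Asymp.Real_Asymp"
begin

text \<open>
  Put \<open>c\<^sub>N = h\<^sub>0 + \<dots> + h\<^sub>N\<^sub>-\<^sub>1\<close>. The recursion for the stepsizes says \<open>(c\<^sub>N + 1/2) (2 - h\<^sub>N\<^sub>-\<^sub>1) = 1\<close>.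
  The quantity \<open>L f(x\<^sub>k) + c\<^sub>k \<parallel>\<nabla>f(x\<^sub>k)\<parallel>\<^sup>2\<close> does not increase along the iterates: this is a combination,
  with weights proportional to \<open>2 h\<^sub>k + 2 c\<^sub>k\<close> and \<open>h\<^sub>k + 2 c\<^sub>k\<close>, of the interpolation inequalities of
  \<open>(x\<^sub>k, x\<^sub>k\<^sub>+\<^sub>1)\<close> and \<open>(x\<^sub>k\<^sub>+\<^sub>1, x\<^sub>k)\<close>, in which the coefficient of \<open>\<parallel>\<nabla>f(x\<^sub>k) - \<nabla>f(x\<^sub>k\<^sub>+\<^sub>1)\<parallel>\<^sup>2\<close>
  vanishes for exactly this choice of stepsizes. Together with
  \<open>\<parallel>\<nabla>f(x\<^sub>N)\<parallel>\<^sup>2 \<le> 2 L (f(x\<^sub>N) - f\<^sub>\<star>)\<close> it gives the upper bound \<open>1 / (c\<^sub>N + 1/2)\<close>. A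
  one-dimensional Huber function whose gradient is constant along all the iterates attains it.
\<close>

section \<open>The stepsize schedule\<close>

text \<open>With \<open>s = sqrt (9 - 4 * stepsize n)\<close> both gaps are rational in
  \<open>s\<close>: \<open>2 - stepsize n = (s - 1) * (s + 1) / 4\<close> and
  \<open>2 - stepsize (Suc n) = (s - 1) / (s + 1)\<close>. The bound \<open>stepsize n < 2\<close>
  travels with the induction because it gives \<open>s > 1\<close>.\<close>

lemma stepsize_sum:
  "1 \<le> stepsize n \<and> stepsize n < 2 \<and> ((\<Sum>k\<le>n. stepsize k) + 1/2) * (2 - stepsize n) = 1"
proof (induction n)
  case 0
  have "sqrt 9 = (3::real)" by (rule real_sqrt_unique) simp_all
  then show ?case by simp
next
  case (Suc n)
  define s where "s = sqrt (9 - 4 * stepsize n)"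
  have s2: "s\<^sup>2 = 9 - 4 * stepsize n" using Suc by (simp add: s_def)
  have s1: "s > 1" using Suc unfolding s_def by (intro real_less_rsqrt) simp
  have h: "stepsize (Suc n) = 1 + 2 / (1 + s)" by (simp add: s_def)
  have "2 - stepsize n = (s - 1) * (s + 1) / 4"
    using s2 by (simp add: algebra_simps power2_eq_square)
  then have "((\<Sum>k\<le>n. stepsize k) + 1/2) * ((s - 1) * (s + 1) / 4) = 1"
    using Suc by metis
  moreover have "(s - 1) * (s + 1) \<noteq> 0" using s1 by simp
  ultimately have "(\<Sum>k\<le>n. stepsize k) + 1/2 = 4 / ((s - 1) * (s + 1))"
    by (metis divide_divide_eq_right eq_divide_eq mult_1 times_divide_eq_right zero_neq_one mult_zero_right)
  then have c: "(\<Sum>k\<le>n. stepsize k) = 4 / ((s - 1) * (s + 1)) - 1/2" by simp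
  have "((\<Sum>k\<le>n. stepsize k) + stepsize (Suc n) + 1/2) * (2 - stepsize (Suc n)) = 1"
    unfolding c h using s1 by (simp add: divide_simps) (simp add: algebra_simps)
  moreover have "1 \<le> stepsize (Suc n)" "stepsize (Suc n) < 2"
    unfolding h using s1 by (simp_all add: field_simps)
  ultimately show ?case by (simp add: atMost_Suc add_ac)
qed

lemma stepsize_ge_1: "1 \<le> stepsize n" and stepsize_less_2: "stepsize n < 2"
  and stepsize_eq_inverse_sum: "2 - stepsize n = 1 / ((\<Sum>k\<le>n. stepsize k) + 1/2)"
proof -
  show "1 \<le> stepsize n" "stepsize n < 2" using stepsize_sum[of n] by auto
  have eq: "((\<Sum>k\<le>n. stepsize k) + 1/2) * (2 - stepsize n) = 1" using stepsize_sum by blast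
  then have "(\<Sum>k\<le>n. stepsize k) + 1/2 \<noteq> 0" by auto
  with eq show "2 - stepsize n = 1 / ((\<Sum>k\<le>n. stepsize k) + 1/2)" by (simp add: field_simps)
qed

lemma sum_stepsize_nonneg: "0 \<le> (\<Sum>k<n. stepsize k)"
  by (rule sum_nonneg) (use stepsize_ge_1 order_trans zero_le_one in blast)

text \<open>This is \<open>stepsize_sum\<close> multiplied out, with the newest step split off the
  sum; the potential argument consumes it in this form.\<close>

lemma stepsize_quadratic:
  defines "c \<equiv> \<lambda>n. \<Sum>k<n. stepsize k"
  shows "(stepsize n)\<^sup>2 + (c n - 3/2) * stepsize n - 2 * c n = 0"
proof -
  have "((\<Sum>k\<le>n. stepsize k) + 1/2) * (2 - stepsize n) = 1" using stepsize_sum by blast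
  moreover have "(\<Sum>k\<le>n. stepsize k) = c n + stepsize n"
    by (simp add: c_def flip: lessThan_Suc_atMost)
  ultimately show ?thesis by (simp add: algebra_simps power2_eq_square)
qed

section \<open>Growth of the stepsize sums and the limit\<close>

lemma sum_stepsize_le: "(\<Sum>k<n. stepsize k) \<le> 2 * real n"
  using sum_bounded_above[of "{..<n}" stepsize 2] stepsize_less_2
  by (simp add: less_imp_le mult.commute)

text \<open>Since every step is at least 1, the deficit \<open>2 - stepsize n\<close> is at most
  \<open>1 / (n + 1)\<close>. The cruder bound \<open>1 / sqrt (n + 1)\<close> telescopes against
  \<open>2 * sqrt n\<close>, and any error of order o(n) is good enough for the limit.\<close>

lemma sum_stepsize_ge: "2 * real n - 2 * sqrt (real n) \<le> (\<Sum>k<n. stepsize k)"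
proof (induction n)
  case (Suc n)
  have "real (Suc n) \<le> (\<Sum>k\<le>n. stepsize k)"
    using sum_bounded_below[of "{..n}" 1 stepsize] stepsize_ge_1 by simp
  then have "2 - stepsize n \<le> 1 / real (Suc n)"
    unfolding stepsize_eq_inverse_sum by (intro divide_left_mono) auto
  also have "\<dots> \<le> 1 / sqrt (real (Suc n))"
  proof (rule divide_left_mono)
    show "sqrt (real (Suc n)) \<le> real (Suc n)" by (rule real_le_lsqrt) (auto simp: power2_eq_square)
  qed auto
  also have "\<dots> \<le> 2 * (sqrt (real (Suc n)) - sqrt (real n))"
  proof -
    let ?a = "sqrt (real (Suc n))" and ?b = "sqrt (real n)"
    have "?a * ?a = real n + 1" "?b * ?b = real n" by simp_all
    moreover have "0 \<le> (?a - ?b) * (?a - ?b)" by simp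
    ultimately have "1 \<le> 2 * (?a - ?b) * ?a" by (simp add: algebra_simps)
    then show ?thesis by (simp add: field_simps)
  qed
  finally show ?case using Suc by simp
qed simp

lemma stepsize_asymptotics:
  "(\<lambda>N. real N * (2 - stepsize (N - 1))) \<longlonglongrightarrow> 1/2"
proof (rule tendsto_sandwich)
  have eq: "2 - stepsize (N - 1) = 1 / ((\<Sum>k<N. stepsize k) + 1/2)" if "N > 0" for N
    using that stepsize_eq_inverse_sum[of "N - 1"] by (simp flip: lessThan_Suc_atMost)
  show "\<forall>\<^sub>F N in sequentially. real N * (1 / (2 * real N + 1/2)) \<le> real N * (2 - stepsize (N - 1))"
    using eventually_gt_at_top[of 0]
  proof eventually_elim
    case (elim N)
    show ?case unfolding eq[OF elim] using sum_stepsize_le[of N] sum_stepsize_nonneg[of N]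
      by (intro mult_left_mono divide_left_mono) auto
  qed
  show "\<forall>\<^sub>F N in sequentially.
      real N * (2 - stepsize (N - 1)) \<le> real N * (1 / (2 * real N - 2 * sqrt (real N) + 1/2))"
    using eventually_gt_at_top[of 0]
  proof eventually_elim
    case (elim N)
    \<comment> \<open>Keeps the denominator \<open>2 * real N - 2 * sqrt (real N) + 1/2\<close>
      positive.\<close>
    have "sqrt (real N) \<le> real N" using elim by (intro real_le_lsqrt) (auto simp: power2_eq_square)
    then show ?case unfolding eq[OF elim] using sum_stepsize_ge[of N] sum_stepsize_nonneg[of N]
      by (intro mult_left_mono divide_left_mono mult_pos_pos) auto
  qed
qed real_asymp+

section \<open>Smooth convex functions\<close>

text \<open>Derivatives of \<open>f\<close> exist only within \<open>Rd d\<close>. A line in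
  \<open>Rd d\<close> stays there, so the chain rule yields an unrestricted derivative in
  \<open>t\<close>, and one-variable calculus applies.\<close>

lemma has_real_derivative_along_line:
  assumes f: "f differentiable_on Rd d" and x: "x \<in> Rd d" and v: "v \<in> Rd d"
  shows "((\<lambda>t. f (x + t *\<^sub>R v)) has_real_derivative grad d f (x + t *\<^sub>R v) \<bullet> v) (at t)"
proof -
  have line: "x + s *\<^sub>R v \<in> Rd d" for s
    by (intro subspace_add[OF subspace_Rd] subspace_scale[OF subspace_Rd] x v)
  have "(f has_derivative (\<lambda>w. grad d f (x + t *\<^sub>R v) \<bullet> w)) (at (x + t *\<^sub>R v) within Rd d)"
    using f line by (intro grad_props) (auto simp: differentiable_on_def)
  then have "(f has_derivative (\<lambda>w. grad d f (x + t *\<^sub>R v) \<bullet> w))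
      (at (x + t *\<^sub>R v) within range (\<lambda>s. x + s *\<^sub>R v))"
    by (rule has_derivative_subset) (use line in auto)
  moreover have "((\<lambda>s. x + s *\<^sub>R v) has_derivative (\<lambda>s. s *\<^sub>R v)) (at t)"
    by (auto intro!: derivative_eq_intros)
  ultimately have "((\<lambda>s. f (x + s *\<^sub>R v)) has_derivative
      (\<lambda>s. grad d f (x + t *\<^sub>R v) \<bullet> (s *\<^sub>R v))) (at t)"
    by (rule has_derivative_in_compose[rotated])
  then show ?thesis by (simp add: has_field_derivative_def mult_commute_abs)
qed

lemma grad_in_Rd: "f \<in> smooth_convex d L \<Longrightarrow> x \<in> Rd d \<Longrightarrow> grad d f x \<in> Rd d"
  by (rule grad_props) (auto simp: smooth_convex_def differentiable_on_def)

text \<open>On the line through \<open>x\<close> and \<open>y\<close> this is the tangent inequality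
  at 0 of a convex function of one variable, evaluated at 1.\<close>

lemma smooth_convex_above_tangent:
  assumes f: "f \<in> smooth_convex d L" and x: "x \<in> Rd d" and y: "y \<in> Rd d"
  shows "f x + grad d f x \<bullet> (y - x) \<le> f y"
proof -
  define v where "v = y - x"
  have v: "v \<in> Rd d" unfolding v_def by (rule subspace_diff[OF subspace_Rd y x])
  have line: "x + s *\<^sub>R v \<in> Rd d" for s
    by (intro subspace_add[OF subspace_Rd] subspace_scale[OF subspace_Rd] x v)
  have conv: "convex_on (Rd d) f" and diff: "f differentiable_on Rd d"
    using f by (auto simp: smooth_convex_def)
  have "convex_on UNIV (\<lambda>t. f (x + t *\<^sub>R v))"
  proof (rule convex_onI)
    fix t a b :: real
    assume "0 < t" "t < 1"
    have "x + ((1 - t) *\<^sub>R a + t *\<^sub>R b) *\<^sub>R v = (1 - t) *\<^sub>R (x + a *\<^sub>R v) + t *\<^sub>R (x + b *\<^sub>R v)"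
      by (simp add: algebra_simps)
    then show "f (x + ((1 - t) *\<^sub>R a + t *\<^sub>R b) *\<^sub>R v)
        \<le> (1 - t) * f (x + a *\<^sub>R v) + t * f (x + b *\<^sub>R v)"
      using convex_onD[OF conv, of t] line \<open>0 < t\<close> \<open>t < 1\<close> by simp
  qed simp
  from convex_on_imp_above_tangent[OF this _ _ _ has_real_derivative_along_line[OF diff x v, of 0], of 1]
  show ?thesis by (simp add: v_def)
qed

text \<open>The descent lemma: \<open>f\<close> minus the linear and quadratic terms is
  nonincreasing along the segment, by Cauchy-Schwarz and the Lipschitz bound on the
  gradient.\<close>

lemma smooth_convex_below_quadratic:
  assumes f: "f \<in> smooth_convex d L" and x: "x \<in> Rd d" and y: "y \<in> Rd d"
  shows "f y \<le> f x + grad d f x \<bullet> (y - x) + L / 2 * (norm (y - x))\<^sup>2"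
proof -
  define v where "v = y - x"
  have v: "v \<in> Rd d" unfolding v_def by (rule subspace_diff[OF subspace_Rd y x])
  have line: "x + s *\<^sub>R v \<in> Rd d" for s
    by (intro subspace_add[OF subspace_Rd] subspace_scale[OF subspace_Rd] x v)
  have lip: "L-lipschitz_on (Rd d) (grad d f)" and diff: "f differentiable_on Rd d"
    using f by (auto simp: smooth_convex_def)
  define \<psi> where "\<psi> t = f (x + t *\<^sub>R v) - t * (grad d f x \<bullet> v) - L / 2 * t\<^sup>2 * (norm v)\<^sup>2" for t
  have "\<psi> 1 \<le> \<psi> 0"
  proof (rule DERIV_nonpos_imp_nonincreasing[where f = \<psi>])
    fix t :: real
    assume t: "0 \<le> t" "t \<le> 1"
    have "(\<psi> has_real_derivative
        grad d f (x + t *\<^sub>R v) \<bullet> v - grad d f x \<bullet> v - L * t * (norm v)\<^sup>2) (at t)"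
      unfolding \<psi>_def
      by (rule derivative_eq_intros has_real_derivative_along_line[OF diff x v] refl)+ simp
    moreover have "(grad d f (x + t *\<^sub>R v) - grad d f x) \<bullet> v \<le> L * t * (norm v)\<^sup>2"
    proof -
      have "norm (grad d f (x + t *\<^sub>R v) - grad d f x) \<le> L * (t * norm v)"
        using lipschitz_onD[OF lip line[of t] x] t by (simp add: dist_norm)
      then have "norm (grad d f (x + t *\<^sub>R v) - grad d f x) * norm v \<le> L * (t * norm v) * norm v"
        by (rule mult_right_mono) simp
      then show ?thesis
        using norm_cauchy_schwarz[of "grad d f (x + t *\<^sub>R v) - grad d f x" v]
        by (simp add: power2_eq_square algebra_simps)
    qed
    ultimately show "\<exists>D. (\<psi> has_real_derivative D) (at t) \<and> D \<le> 0"
      unfolding inner_diff_left by (metis diff_le_0_iff_le)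
  qed simp
  then show ?thesis by (simp add: \<psi>_def v_def)
qed

text \<open>The tangent at \<open>x\<close> lies below the quadratic upper bound at
  \<open>y\<close>. The point \<open>z\<close> minimizes the difference of the two, which makes the
  comparison there the strongest.\<close>

lemma smooth_convex_interpolation:
  assumes f: "f \<in> smooth_convex d L" and L: "L > 0" and x: "x \<in> Rd d" and y: "y \<in> Rd d"
  shows "f x + grad d f x \<bullet> (y - x) + (norm (grad d f y - grad d f x))\<^sup>2 / (2 * L) \<le> f y"
proof -
  define w where "w = grad d f y - grad d f x"
  define z where "z = y - (1 / L) *\<^sub>R w"
  have "z \<in> Rd d" unfolding z_def w_def
    by (intro subspace_diff[OF subspace_Rd] subspace_scale[OF subspace_Rd] grad_in_Rd[OF f] x y)
  then have "f x + grad d f x \<bullet> (z - x) \<le> f y + grad d f y \<bullet> (z - y) + L / 2 * (norm (z - y))\<^sup>2"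
    using smooth_convex_above_tangent[OF f x] smooth_convex_below_quadratic[OF f y]
    by (meson order_trans)
  moreover have "grad d f x \<bullet> (z - x) = grad d f x \<bullet> (y - x) - (grad d f x \<bullet> w) / L"
    by (simp add: z_def inner_diff_right)
  moreover have "grad d f y \<bullet> (z - y) = - (grad d f y \<bullet> w) / L"
    by (simp add: z_def)
  moreover have "L / 2 * (norm (z - y))\<^sup>2 = (norm w)\<^sup>2 / (2 * L)"
    using L by (simp add: z_def power_mult_distrib power_divide power2_eq_square)
  moreover have "(grad d f y \<bullet> w) / L - (grad d f x \<bullet> w) / L = 2 * ((norm w)\<^sup>2 / (2 * L))"
    by (simp add: w_def power2_norm_eq_inner inner_diff_left diff_divide_distrib)
  ultimately show ?thesis by (simp add: w_def)
qed

text \<open>A gradient step of length \<open>1 / L\<close> minimizes the quadratic upper bound at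
  \<open>y\<close>, and its value is still at least the infimum.\<close>

lemma norm_grad_le_fstar:
  assumes f: "f \<in> smooth_convex d L" and L: "L > 0" and y: "y \<in> Rd d"
  shows "(norm (grad d f y))\<^sup>2 / (2 * L) \<le> f y - fstar d f"
proof -
  \<comment> \<open>The minimum serves as the lower bound without which a real infimum need not lie
    below the values.\<close>
  obtain m where m: "\<And>x. x \<in> Rd d \<Longrightarrow> m \<le> f x" using f by (auto simp: smooth_convex_def)
  define z where "z = y - (1 / L) *\<^sub>R grad d f y"
  have z: "z \<in> Rd d" unfolding z_def
    by (intro subspace_diff[OF subspace_Rd] subspace_scale[OF subspace_Rd] grad_in_Rd[OF f] y)
  have "fstar d f \<le> f z" unfolding fstar_def using m z by (intro cINF_lower bdd_belowI2) auto
  also have "\<dots> \<le> f y + grad d f y \<bullet> (z - y) + L / 2 * (norm (z - y))\<^sup>2"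
    by (rule smooth_convex_below_quadratic[OF f y z])
  also have "\<dots> = f y - (norm (grad d f y))\<^sup>2 / (2 * L)"
    using L by (simp add: z_def power_mult_distrib power_divide power2_norm_eq_inner[symmetric])
      (simp add: field_simps power2_eq_square)
  finally show ?thesis by simp
qed

section \<open>The upper bound\<close>

lemma gradient_descent_in_Rd:
  assumes "f \<in> smooth_convex d L" "x0 \<in> Rd d"
  shows "gradient_descent L h d f x0 k \<in> Rd d"
  by (induction k)
    (auto intro!: assms subspace_diff[OF subspace_Rd] subspace_scale[OF subspace_Rd] grad_in_Rd)

text \<open>Here \<open>c\<close> is the weight before the step and \<open>c + h\<close> the weight
  after it. The multipliers \<open>2 * h + 2 * c\<close> and \<open>h + 2 * c\<close> differ by
  \<open>h\<close>, so \<open>h\<close> times the decrease of \<open>L * f\<close> survives the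
  combination.\<close>

lemma gradient_step_potential:
  assumes f: "f \<in> smooth_convex d L" and L: "L > 0" and x: "x \<in> Rd d"
    and h: "h > 0" and c: "c \<ge> 0" and hc: "h\<^sup>2 + (c - 3/2) * h - 2 * c = 0"
  defines "y \<equiv> x - (h / L) *\<^sub>R grad d f x"
  shows "L * f y + (c + h) * (norm (grad d f y))\<^sup>2 \<le> L * f x + c * (norm (grad d f x))\<^sup>2"
proof -
  let ?g = "grad d f x" and ?g' = "grad d f y"
  define a b I where "a = (norm ?g)\<^sup>2" and "b = (norm ?g')\<^sup>2" and "I = ?g \<bullet> ?g'"
  have y: "y \<in> Rd d" unfolding y_def
    by (intro subspace_diff[OF subspace_Rd] subspace_scale[OF subspace_Rd] grad_in_Rd[OF f] x)
  have half: "L * (u / (2 * L)) = u / 2" for u using L by simp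
  have sq: "(norm (?g - ?g'))\<^sup>2 = a - 2 * I + b" "(norm (?g' - ?g))\<^sup>2 = a - 2 * I + b"
    by (simp_all add: a_def b_def I_def power2_norm_eq_inner inner_diff inner_commute)
  have "f y + h / L * I + (a - 2 * I + b) / (2 * L) \<le> f x"
    using smooth_convex_interpolation[OF f L y x] unfolding sq
    by (simp add: y_def I_def inner_commute)
  then have "L * (f y + h / L * I + (a - 2 * I + b) / (2 * L)) \<le> L * f x"
    using L by (intro mult_left_mono) auto
  then have "L * f y + h * I + (a - 2 * I + b) / 2 \<le> L * f x"
    using L by (simp only: distrib_left half) simp
  then have A: "(2 * h + 2 * c) * (L * f y + h * I + (a - 2 * I + b) / 2) \<le> (2 * h + 2 * c) * (L * f x)"
    using h c by (intro mult_left_mono) auto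
  have "f x - h / L * a + (a - 2 * I + b) / (2 * L) \<le> f y"
    using smooth_convex_interpolation[OF f L x y] unfolding sq
    by (simp add: y_def a_def power2_norm_eq_inner)
  then have "L * (f x - h / L * a + (a - 2 * I + b) / (2 * L)) \<le> L * f y"
    using L by (intro mult_left_mono) auto
  then have "L * f x - h * a + (a - 2 * I + b) / 2 \<le> L * f y"
    using L by (simp only: distrib_left right_diff_distrib half) simp
  then have B: "(h + 2 * c) * (L * f x - h * a + (a - 2 * I + b) / 2) \<le> (h + 2 * c) * (L * f y)"
    using h c by (intro mult_left_mono) auto
  \<comment> \<open>A polynomial identity: \<open>h\<close> times the decrease of the potential is
    the sum of the weighted slacks of \<open>A\<close> and \<open>B\<close>, up to a multiple of the
    expression that \<open>hc\<close> sets to 0.\<close>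
  have "h * (L * f x + c * a - (L * f y + (c + h) * b))
      = (2 * h + 2 * c) * (L * f x) - (2 * h + 2 * c) * (L * f y + h * I + (a - 2 * I + b) / 2)
        + ((h + 2 * c) * (L * f y) - (h + 2 * c) * (L * f x - h * a + (a - 2 * I + b) / 2))
        - (h\<^sup>2 + (c - 3/2) * h - 2 * c) * (a - 2 * I + b)"
    by (simp add: field_simps power2_eq_square)
  then have "0 \<le> h * (L * f x + c * a - (L * f y + (c + h) * b))"
    using A B hc by simp
  then show ?thesis using h by (simp add: zero_le_mult_iff a_def b_def)
qed

text \<open>The potential starts at \<open>L * f x0\<close>, the empty sum being 0. The extra
  \<open>1/2\<close> comes from \<open>norm_grad_le_fstar\<close> at the last iterate.\<close>

lemma gradient_descent_bound:
  assumes f: "f \<in> smooth_convex d L" and L: "L > 0" and x0: "x0 \<in> Rd d"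
  defines "x \<equiv> gradient_descent L stepsize d f x0"
  shows "((\<Sum>k<N. stepsize k) + 1/2) * (norm (grad d f (x N)))\<^sup>2 \<le> L * (f x0 - fstar d f)"
proof -
  have x: "x k \<in> Rd d" for k unfolding x_def by (rule gradient_descent_in_Rd[OF f x0])
  have "L * f (x N) + (\<Sum>k<N. stepsize k) * (norm (grad d f (x N)))\<^sup>2 \<le> L * f x0"
  proof (induction N)
    case 0
    then show ?case by (simp add: x_def)
  next
    case (Suc N)
    have "0 < stepsize N" using stepsize_ge_1[of N] by simp
    from gradient_step_potential[OF f L x this sum_stepsize_nonneg stepsize_quadratic, of N]
    show ?case using Suc by (simp add: x_def)
  qed
  moreover have "(norm (grad d f (x N)))\<^sup>2 / 2 \<le> L * (f (x N) - fstar d f)"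
    using norm_grad_le_fstar[OF f L x, of N] L by (simp add: field_simps)
  ultimately show ?thesis by (simp add: algebra_simps)
qed

section \<open>The worst-case function\<close>

text \<open>The difference quotient of the error is at most \<open>K * norm (y - x)\<close>. This
  handles the kink of the Huber function together with all other points.\<close>

lemma has_derivative_within_quadratic_error:
  fixes f :: "'a::real_inner \<Rightarrow> real"
  assumes "\<And>y. y \<in> S \<Longrightarrow> \<bar>f y - f x - g \<bullet> (y - x)\<bar> \<le> K * (norm (y - x))\<^sup>2"
  shows "(f has_derivative (\<lambda>v. g \<bullet> v)) (at x within S)"
  unfolding has_derivative_within
proof
  show "bounded_linear ((\<bullet>) g)" by (rule bounded_linear_inner_right)
  show "((\<lambda>y. (1 / norm (y - x)) *\<^sub>R (f y - (f x + g \<bullet> (y - x)))) \<longlongrightarrow> 0) (at x within S)"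
  proof (rule Lim_null_comparison)
    have "((\<lambda>y. K * norm (y - x)) \<longlongrightarrow> K * norm (x - x)) (at x within S)"
      by (intro tendsto_intros)
    then show "((\<lambda>y. K * norm (y - x)) \<longlongrightarrow> 0) (at x within S)" by simp
    show "\<forall>\<^sub>F y in at x within S.
        norm ((1 / norm (y - x)) *\<^sub>R (f y - (f x + g \<bullet> (y - x)))) \<le> K * norm (y - x)"
      unfolding eventually_at_filter
    proof (rule always_eventually, intro allI impI)
      fix y
      assume "y \<noteq> x" "y \<in> S"
      with assms[of y] show "norm ((1 / norm (y - x)) *\<^sub>R (f y - (f x + g \<bullet> (y - x))))
          \<le> K * norm (y - x)"
        by (simp add: field_simps power2_eq_square abs_mult)
    qed
  qed
qed

text \<open>Averaging the supporting inequalities at the intermediate point \<open>z\<close> cancels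
  the linear terms.\<close>

lemma convex_on_of_supporting_hyperplanes:
  fixes f :: "'a::real_inner \<Rightarrow> real"
  assumes S: "convex S" and g: "\<And>x y. x \<in> S \<Longrightarrow> y \<in> S \<Longrightarrow> f x + g x \<bullet> (y - x) \<le> f y"
  shows "convex_on S f"
proof (rule convex_onI)
  fix t :: real and x y
  assume t: "0 < t" "t < 1" and x: "x \<in> S" and y: "y \<in> S"
  define z where "z = (1 - t) *\<^sub>R x + t *\<^sub>R y"
  have z: "z \<in> S" unfolding z_def using S x y t by (intro convexD) auto
  have "(1 - t) * (f z + g z \<bullet> (x - z)) + t * (f z + g z \<bullet> (y - z)) \<le> (1 - t) * f x + t * f y"
    using t by (intro add_mono mult_left_mono g x y z) auto
  also have "(1 - t) * (f z + g z \<bullet> (x - z)) + t * (f z + g z \<bullet> (y - z))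
      = f z + g z \<bullet> ((1 - t) *\<^sub>R (x - z) + t *\<^sub>R (y - z))"
    by (simp add: inner_add_right algebra_simps)
  also have "(1 - t) *\<^sub>R (x - z) + t *\<^sub>R (y - z) = 0"
    by (simp add: z_def algebra_simps)
  finally show "f ((1 - t) *\<^sub>R x + t *\<^sub>R y) \<le> (1 - t) * f x + t * f y"
    by (simp add: z_def)
qed (rule S)

section \<open>The one-sided Huber function on the real line\<close>

lift_definition axis0 :: "real \<Rightarrow> fseq" is "\<lambda>t i. if i = 0 then t else 0"
  by simp

lemma coord_axis0 [simp]: "coord (axis0 t) i = (if i = 0 then t else 0)"
  by transfer simp

lemma axis0_in_Rd1: "axis0 t \<in> Rd 1"
  by (simp add: Rd_def)

lemma axis0_diff: "axis0 s - axis0 t = axis0 (s - t)"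
  by (rule fseq_eqI) simp

lemma norm_Rd1: "x \<in> Rd 1 \<Longrightarrow> norm x = \<bar>coord x 0\<bar>"
  by (simp add: norm_Rd L2_set_def)

lemma inner_Rd1: "x \<in> Rd 1 \<Longrightarrow> x \<bullet> y = coord x 0 * coord y 0"
  by (simp add: inner_Rd)

text \<open>Only one side of the Huber function is flattened; the other one stays quadratic.\<close>

definition huber :: "real \<Rightarrow> fseq \<Rightarrow> real" where
  "huber L x = (if coord x 0 \<le> 1 then L * (coord x 0)\<^sup>2 / 2 else L * (coord x 0 - 1/2))"

text \<open>The first-order remainder \<open>e\<close> carries all the analysis: its sign gives
  convexity, and both bounds together give the derivative.\<close>

lemma huber_bounds:
  assumes L: "L > 0"
  defines "e \<equiv> \<lambda>x y. huber L y - huber L x - L * min (coord x 0) 1 * (coord y 0 - coord x 0)"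
  shows "0 \<le> e x y" "e x y \<le> L / 2 * (coord y 0 - coord x 0)\<^sup>2"
proof -
  define s t where "s = coord x 0" and "t = coord y 0"
  define \<phi> where "\<phi> u = (if u \<le> 1 then u\<^sup>2 / 2 else u - 1/2)" for u :: real
  have e: "e x y = L * (\<phi> t - \<phi> s - min s 1 * (t - s))"
    by (simp add: e_def huber_def \<phi>_def s_def t_def algebra_simps)
  have sq: "0 \<le> (t - s)\<^sup>2" "0 \<le> (t - 1)\<^sup>2" "0 \<le> (s - 1)\<^sup>2" by simp_all
  have "0 \<le> \<phi> t - \<phi> s - min s 1 * (t - s) \<and> \<phi> t - \<phi> s - min s 1 * (t - s) \<le> (t - s)\<^sup>2 / 2"
  \<comment> \<open>If the kink separates \<open>s\<close> and \<open>t\<close>, split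
    \<open>t - s\<close> as \<open>(t - 1) + (1 - s)\<close>; the cross term is then
    nonnegative.\<close>
  proof (cases "s \<le> 1"; cases "t \<le> 1")
    assume st: "s \<le> 1" "\<not> t \<le> 1"
    then have "0 \<le> (1 - s) * (t - 1)" by simp
    with st sq show ?thesis
      by (auto simp: \<phi>_def min_def power2_eq_square algebra_simps)
  next
    assume st: "\<not> s \<le> 1" "t \<le> 1"
    then have "0 \<le> (s - 1) * (1 - t)" by simp
    with st sq show ?thesis
      by (auto simp: \<phi>_def min_def power2_eq_square algebra_simps)
  qed (use sq in \<open>auto simp: \<phi>_def min_def power2_eq_square algebra_simps\<close>)
  then show "0 \<le> e x y" "e x y \<le> L / 2 * (coord y 0 - coord x 0)\<^sup>2"
    using L mult_left_mono[of _ "(t - s)\<^sup>2 / 2" L] by (auto simp: e s_def t_def)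
qed

lemma huber_has_derivative:
  assumes L: "L > 0" and x: "x \<in> Rd 1"
  shows "(huber L has_derivative (\<lambda>v. axis0 (L * min (coord x 0) 1) \<bullet> v)) (at x within Rd 1)"
proof (rule has_derivative_within_quadratic_error)
  fix y
  assume "y \<in> Rd 1"
  then have "norm (y - x) = \<bar>coord y 0 - coord x 0\<bar>"
    using x by (simp add: norm_Rd1 subspace_diff[OF subspace_Rd])
  then show "\<bar>huber L y - huber L x - axis0 (L * min (coord x 0) 1) \<bullet> (y - x)\<bar>
      \<le> L / 2 * (norm (y - x))\<^sup>2"
    using huber_bounds[OF L, of y x] by (simp add: inner_Rd1[OF axis0_in_Rd1])
qed

lemma grad_huber:
  assumes "L > 0" "x \<in> Rd 1"
  shows "grad 1 (huber L) x = axis0 (L * min (coord x 0) 1)"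
proof -
  note D = huber_has_derivative[OF assms]
  have d: "huber L differentiable (at x within Rd 1)" using D by (auto simp: differentiable_def)
  show ?thesis
    by (rule gradient_unique[OF assms(2) grad_props(1)[OF assms(2) d] axis0_in_Rd1
          grad_props(2)[OF assms(2) d] D])
qed

lemma huber_nonneg: "L > 0 \<Longrightarrow> 0 \<le> huber L x"
  by (simp add: huber_def)

lemma huber_zero: "huber L 0 = 0"
  by (simp add: huber_def)

lemma huber_smooth_convex:
  assumes L: "L > 0"
  shows "huber L \<in> smooth_convex 1 L"
proof -
  have "convex_on (Rd 1) (huber L)"
  proof (rule convex_on_of_supporting_hyperplanes)
    fix x y
    show "huber L x + axis0 (L * min (coord x 0) 1) \<bullet> (y - x) \<le> huber L y"
      using huber_bounds(1)[OF L, of y x] by (simp add: inner_Rd1[OF axis0_in_Rd1])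
  qed (rule subspace_imp_convex[OF subspace_Rd])
  moreover have "huber L differentiable_on Rd 1"
    using huber_has_derivative[OF L] by (auto simp: differentiable_on_def differentiable_def)
  moreover have "\<exists>z\<in>Rd 1. \<forall>x\<in>Rd 1. huber L z \<le> huber L x"
    using huber_nonneg[OF L] by (intro bexI[of _ 0]) (auto simp: huber_zero Rd_def)
  moreover have "L-lipschitz_on (Rd 1) (grad 1 (huber L))"
  proof (rule lipschitz_onI)
    fix x y
    assume xy: "x \<in> Rd 1" "y \<in> Rd 1"
    have "norm (axis0 (L * min (coord x 0) 1) - axis0 (L * min (coord y 0) 1))
        = L * \<bar>min (coord x 0) 1 - min (coord y 0) 1\<bar>"
      unfolding axis0_diff norm_Rd1[OF axis0_in_Rd1] using L
      by (simp add: abs_mult flip: right_diff_distrib)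
    also have "\<dots> \<le> L * \<bar>coord x 0 - coord y 0\<bar>"
      using L by (intro mult_left_mono) auto
    finally show "dist (grad 1 (huber L) x) (grad 1 (huber L) y) \<le> L * dist x y"
      using xy by (simp add: dist_norm grad_huber[OF L] norm_Rd1 subspace_diff[OF subspace_Rd]
          del: One_nat_def)
  qed (use L in simp)
  ultimately show ?thesis by (simp add: smooth_convex_def)
qed

lemma fstar_huber:
  assumes L: "L > 0"
  shows "fstar 1 (huber L) = 0"
  unfolding fstar_def
proof (rule cInf_eq_minimum)
  show "0 \<in> huber L ` Rd 1" by (rule image_eqI[of _ _ 0]) (simp_all add: huber_zero Rd_def)
qed (auto simp: huber_nonneg[OF L])

text \<open>To the right of 1 the gradient is constantly \<open>L\<close>, so step \<open>k\<close>
  moves left by exactly \<open>h k\<close>. The start is chosen so that iterate \<open>N\<close>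
  lands on the kink, where the gradient is still \<open>L\<close>.\<close>

lemma gradient_descent_huber:
  assumes L: "L > 0" and h: "\<And>k. h k \<ge> 0" and "k \<le> N"
  shows "gradient_descent L h 1 (huber L) (axis0 (1 + (\<Sum>i<N. h i))) k
    = axis0 (1 + (\<Sum>i=k..<N. h i))"
  using \<open>k \<le> N\<close>
proof (induction k)
  case 0
  then show ?case by (simp add: atLeast0LessThan)
next
  case (Suc k)
  have "(\<Sum>i=k..<N. h i) = h k + (\<Sum>i=Suc k..<N. h i)"
    using Suc.prems by (intro sum.atLeast_Suc_lessThan) simp
  moreover have "0 \<le> (\<Sum>i=k..<N. h i)" using h by (simp add: sum_nonneg)
  moreover have "0 \<le> (\<Sum>i=Suc k..<N. h i)" using h by (simp add: sum_nonneg)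
  moreover have "gradient_descent L h 1 (huber L) (axis0 (1 + (\<Sum>i<N. h i))) k
      = axis0 (1 + (\<Sum>i=k..<N. h i))"
    using Suc by simp
  ultimately show ?case
    using L h[of k] by (auto simp: grad_huber axis0_in_Rd1 min_def intro!: fseq_eqI simp del: One_nat_def)
qed

section \<open>The worst-case bound\<close>

lemma worst_case_stepsize:
  assumes L: "L > 0"
  shows "worst_case L (gradient_descent L stepsize) N = ereal (1 / ((\<Sum>k<N. stepsize k) + 1/2))"
  unfolding worst_case_def
proof (rule Sup_eqI)
  let ?c = "\<Sum>k<N. stepsize k"
  have c: "?c + 1/2 > 0" using sum_stepsize_nonneg[of N] by simp
  let ?R = "\<lambda>d f x0. ereal ((norm (grad d f (gradient_descent L stepsize d f x0 N)))\<^sup>2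
      / (L * (f x0 - fstar d f)))"
  let ?V = "{?R d f x0 | d f x0.
    d \<ge> 1 \<and> f \<in> smooth_convex d L \<and> x0 \<in> Rd d \<and> f x0 > fstar d f}"
  show "v \<le> ereal (1 / (?c + 1/2))" if v: "v \<in> ?V" for v
  proof -
    obtain d f x0 where v: "v = ?R d f x0"
      and f: "f \<in> smooth_convex d L" and x0: "x0 \<in> Rd d" and gt: "f x0 > fstar d f"
      using v by blast
    have P: "L * (f x0 - fstar d f) > 0" using L gt by simp
    show ?thesis
      unfolding v ereal_less_eq pos_divide_le_eq[OF P] times_divide_eq_left mult_1
        pos_le_divide_eq[OF c]
      using gradient_descent_bound[OF f L x0, of N] by (simp only: mult.commute)
  qed
  show "ereal (1 / (?c + 1/2)) \<le> u" if u: "\<And>v. v \<in> ?V \<Longrightarrow> v \<le> u" for u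
  proof -
    let ?x0 = "axis0 (1 + ?c)"
    \<comment> \<open>If \<open>?c = 0\<close> the start is the kink itself, which belongs to the
      quadratic branch.\<close>
    have f0: "huber L ?x0 = L * (?c + 1/2)"
      using sum_stepsize_nonneg[of N] by (cases "?c = 0") (auto simp: huber_def)
    have "gradient_descent L stepsize 1 (huber L) ?x0 N = axis0 1"
      using gradient_descent_huber[OF L, of stepsize N N] stepsize_ge_1
      by (simp add: order_trans[OF zero_le_one])
    then have "norm (grad 1 (huber L) (gradient_descent L stepsize 1 (huber L) ?x0 N)) = L"
      unfolding \<open>gradient_descent L stepsize 1 (huber L) ?x0 N = axis0 1\<close>
        grad_huber[OF L axis0_in_Rd1] norm_Rd1[OF axis0_in_Rd1] using L by simp
    then have "?R 1 (huber L) ?x0 = ereal (1 / (?c + 1/2))"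
      unfolding f0 fstar_huber[OF L] using L c by (simp add: power2_eq_square)
    moreover have "?R 1 (huber L) ?x0 \<in> ?V"
    proof -
      have "huber L ?x0 > fstar 1 (huber L)"
        unfolding f0 fstar_huber[OF L] using L c by simp
      then show ?thesis
        by (intro CollectI exI[of _ 1] exI[of _ "huber L"] exI[of _ ?x0] conjI refl huber_smooth_convex[OF L] axis0_in_Rd1 order_refl)
    qed
    ultimately show ?thesis using u[of "?R 1 (huber L) ?x0"] by (simp only:)
  qed
qed

theorem mainTheorem6:
  fixes L :: real
  assumes "L > 0"
  shows "(\<forall>N\<ge>1. worst_case L (gradient_descent L stepsize) N = ereal (2 - stepsize (N - 1)))
    \<and> (\<lambda>N. ereal (real N) * worst_case L (gradient_descent L stepsize) N) \<longlonglongrightarrow> ereal (1 / 2)"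
proof
  show *: "\<forall>N\<ge>1. worst_case L (gradient_descent L stepsize) N = ereal (2 - stepsize (N - 1))"
  proof (intro allI impI)
    fix N :: nat
    assume "N \<ge> 1"
    then show "worst_case L (gradient_descent L stepsize) N = ereal (2 - stepsize (N - 1))"
      using stepsize_eq_inverse_sum[of "N - 1"]
      by (simp add: worst_case_stepsize[OF assms] flip: lessThan_Suc_atMost)
  qed
  have "(\<lambda>N. ereal (real N * (2 - stepsize (N - 1)))) \<longlonglongrightarrow> ereal (1 / 2)"
    using stepsize_asymptotics by simp
  \<comment> \<open>The closed form is available from \<open>N = 1\<close> on, since
    \<open>N - 1\<close> truncates at 0; the limit only needs eventual equality.\<close>
  moreover have "\<forall>\<^sub>F N in sequentially. ereal (real N * (2 - stepsize (N - 1)))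
      = ereal (real N) * worst_case L (gradient_descent L stepsize) N"
    using eventually_ge_at_top[of 1] by eventually_elim (use * in simp)
  ultimately show "(\<lambda>N. ereal (real N) * worst_case L (gradient_descent L stepsize) N)
      \<longlonglongrightarrow> ereal (1 / 2)"
    by (rule Lim_transform_eventually)
qed

end
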